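(* We have $S(5)=2$. Furthermore, if $\mathcal{F}$ is a family of $5$ unit squares covering a square $S$ of edge length $2$, then at least one element of $\mathcal{F}$ has sides parallel to those of $S$.
   Context: All squares are closed (solid) squares in the Euclidean plane $\mathbb{R}^2$, arbitrarily positioned and oriented; a unit square is a square of edge length $1$. A family of sets covers a set $X$ if $X$ is contained in the union of the family. For a positive integer $n$, $S(n)$ denotes the largest value such that a square of edge length $S(n)$ can be covered by $n$ unit squares. *)

theory Defs
  imports "HOL-Analysis.Analysis"
begin

text \<open>The closed solid square with corner \<open>p\<close> and sides of length \<open>s\<close> along
  the orthonormal vectors \<open>u\<close> and \<open>v\<close>.\<close>
definition is_square :: "real \<Rightarrow> (real ^ 2) set \<Rightarrow> bool" where
  "is_square s Q \<longleftrightarrow> s > 0 \<and>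
    (\<exists>p u v. norm u = 1 \<and> norm v = 1 \<and> u \<bullet> v = 0 \<and>
       Q = {p + a *\<^sub>R u + b *\<^sub>R v | a b. a \<in> {0..s} \<and> b \<in> {0..s}})"

text \<open>Families are indexed, so members may coincide.\<close>
definition unit_squares :: "nat \<Rightarrow> (nat \<Rightarrow> (real ^ 2) set) \<Rightarrow> bool" where
  "unit_squares n F \<longleftrightarrow> (\<forall>i<n. is_square 1 (F i))"

definition coverable :: "nat \<Rightarrow> real \<Rightarrow> bool" where
  "coverable n s \<longleftrightarrow> (\<exists>Q F. is_square s Q \<and> unit_squares n F \<and> Q \<subseteq> (\<Union>i<n. F i))"

definition S :: "nat \<Rightarrow> real" where
  "S n = (GREATEST s. coverable n s)"

text \<open>The sides of a square are its one-dimensional faces; two sides are parallel iff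
  the lines spanned by them are translates of each other (coinciding lines included).\<close>
definition sides_parallel :: "(real ^ 2) set \<Rightarrow> (real ^ 2) set \<Rightarrow> bool" where
  "sides_parallel P Q \<longleftrightarrow>
    (\<forall>e. e edge_of P \<longrightarrow>
      (\<exists>f. f edge_of Q \<and> affine_parallel (affine hull e) (affine hull f)))"

end

theory Submission imports Defs begin

text \<open>
  The cover with five unit squares of a square with side 2 uses only four of them. For the rest, let
  five unit squares cover a square \<open>Q\<close> with side \<open>l \<ge> 2\<close>, and call a unit square tilted if its
  sides are not parallel to those of \<open>Q\<close>. It suffices to refute the cases that \<open>l > 2\<close> or that all
  five squares are tilted.

  A unit square has diameter \<open>sqrt 2 < 2\<close>, so the four corners of \<open>Q\<close> lie in four different squares
  of the family, and none of these reaches two opposite sides of \<open>Q\<close>. One square \<open>E\<close> is left over.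

  If \<open>E\<close> misses the boundary of \<open>Q\<close>, then each side of \<open>Q\<close> is covered by the two squares at its ends,
  and by connectedness these two share a point of the side. The four shared points cut the boundary,
  of length \<open>4 l\<close>, into one pair of legs for each corner square. But a unit square that
  contains a right-angled corner with axis-parallel legs has total leg length at most 2, and less
  than 2 if it is tilted (\<open>legs_le_2\<close>). So \<open>4 l \<le> 8\<close>, strictly if the squares are tilted.

  If \<open>E\<close> meets a side of \<open>Q\<close>, say the bottom, then \<open>E\<close> and the two squares at the bottom corners
  rise to height at most \<open>sqrt 2 < 1.42 \<le> l - 0.58\<close> above the bottom. Hence the horizontal chords of \<open>Q\<close> at the heights
  \<open>l\<close> and \<open>l - 0.58\<close> are covered by just the two squares at the top corners. Each of these
  then contains a right trapezoid with a vertical side of length \<open>0.58\<close> along the boundary of \<open>Q\<close>, and the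
  four horizontal sides of the two trapezoids have total length \<open>2 l\<close>. But in a unit square the two
  horizontal sides of such a trapezoid have total length at most 2, and less than 2 if the square is
  tilted (\<open>trapezoid_le_2\<close>): a small tilt can lengthen one of the two sides to
  second order only while it shortens the other to first order, and a large tilt shortens both. So \<open>2 l \<le> 4\<close>, again strictly in the tilted case.
\<close>

section \<open>Unit squares in the coordinates of the covered square\<close>

text \<open>A unit square enters the argument only through its widths in the directions of its
  own sides, \<open>(c, s)\<close> and \<open>(- s, c)\<close> in the coordinates of the covered square. All closed subsets
  of a unit square qualify as well. The square is tilted iff \<open>c * s \<noteq> 0\<close>.\<close>
definition fits :: "real \<Rightarrow> real \<Rightarrow> (real \<times> real) set \<Rightarrow> bool" where
  "fits c s K \<longleftrightarrow> closed K \<and> c\<^sup>2 + s\<^sup>2 = 1 \<and>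
    (\<forall>x y x' y'. (x, y) \<in> K \<longrightarrow> (x', y') \<in> K \<longrightarrow>
       \<bar>c * (x - x') + s * (y - y')\<bar> \<le> 1 \<and> \<bar>c * (y - y') - s * (x - x')\<bar> \<le> 1)"

lemma fitsD:
  assumes "fits c s K" "(x, y) \<in> K" "(x', y') \<in> K"
  shows "\<bar>c * (x - x') + s * (y - y')\<bar> \<le> 1" "\<bar>c * (y - y') - s * (x - x')\<bar> \<le> 1"
  using assms unfolding fits_def by blast+

lemma fits_unit: "fits c s K \<Longrightarrow> c\<^sup>2 + s\<^sup>2 = 1"
  by (simp add: fits_def)

lemma fits_dist:
  assumes "fits c s K" "(x, y) \<in> K" "(x', y') \<in> K"
  shows "(x - x')\<^sup>2 + (y - y')\<^sup>2 \<le> 2"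
proof -
  define f g where "f = c * (x - x') + s * (y - y')" and "g = c * (y - y') - s * (x - x')"
  have "f\<^sup>2 \<le> 1" "g\<^sup>2 \<le> 1"
    using fitsD[OF assms] unfolding f_def g_def by (simp_all add: abs_square_le_1)
  moreover have "f\<^sup>2 + g\<^sup>2 = (c\<^sup>2 + s\<^sup>2) * ((x - x')\<^sup>2 + (y - y')\<^sup>2)"
    unfolding f_def g_def by (simp add: power2_eq_square algebra_simps)
  ultimately show ?thesis using fits_unit[OF assms(1)] by simp
qed

text \<open>The quantitative form, with \<open>1.42 > sqrt 2\<close>, in which the diameter of a unit square is used.\<close>
lemma fits_apart:
  assumes "fits c s K" "(x, y) \<in> K" "\<bar>x - x'\<bar> \<ge> 142/100 \<or> \<bar>y - y'\<bar> \<ge> 142/100"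
  shows "(x', y') \<notin> K"
proof
  assume "(x', y') \<in> K"
  note d = fits_dist[OF assms(1,2) this]
  have sq: "z\<^sup>2 > 2" if "\<bar>z\<bar> \<ge> 142/100" for z :: real
  proof -
    have "(142/100)\<^sup>2 \<le> \<bar>z\<bar>\<^sup>2" by (rule power_mono) (use that in auto)
    then show ?thesis by (simp add: power2_eq_square)
  qed
  show False
    using assms(3) sq[of "x - x'"] sq[of "y - y'"] d
      zero_le_power2[of "x - x'"] zero_le_power2[of "y - y'"] by linarith
qed

text \<open>Exchanging the coordinates carries what is shown for the horizontal sides of the covered
  square over to the vertical ones.\<close>
lemma fits_swap:
  assumes "fits c s K"
  shows "fits s c {(x, y). (y, x) \<in> K}"
proof -
  have "{(x, y). (y, x) \<in> K} = prod.swap -` K" by auto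
  moreover have "closed (prod.swap -` K)"
    using assms unfolding fits_def prod.swap_def
    by (intro continuous_closed_vimage) (auto intro!: continuous_intros)
  ultimately have "closed {(x, y). (y, x) \<in> K}" by simp
  moreover have "\<bar>s * (x - x') + c * (y - y')\<bar> \<le> 1" "\<bar>s * (y - y') - c * (x - x')\<bar> \<le> 1"
    if "(y, x) \<in> K" "(y', x') \<in> K" for x y x' y'
    using fitsD[OF assms that] by (simp_all add: abs_minus_commute add.commute)
  ultimately show ?thesis
    using fits_unit[OF assms] unfolding fits_def by (auto simp: add.commute)
qed

section \<open>Legs and trapezoids inside a unit square\<close>

lemma abs_add_same_sign:
  fixes a b :: real
  assumes "a * b \<ge> 0"
  shows "\<bar>a + b\<bar> = \<bar>a\<bar> + \<bar>b\<bar>"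
  using assms by (auto simp: abs_if zero_le_mult_iff mult_less_0_iff)

text \<open>The extremal problem behind \<open>legs_le_2\<close>, with \<open>C\<close>, \<open>S\<close> the cosine and sine of the tilt.
  It is a linear program in the legs. For \<open>S \<le> C\<close> the maximum is attained at \<open>a = 1 / C\<close> with equality in
  the last constraint, and has the value \<open>(2 C - S) / C\<^sup>2\<close>. This is at most 2 because
  \<open>2 C\<^sup>2 - (2 C - S) = S - 2 C (1 - C)\<close> has the same sign as \<open>S (1 + C - 2 C S)\<close>.\<close>
lemma legs_le_2_nonneg:
  fixes a b C S :: real
  assumes CS: "C \<ge> 0" "S \<ge> 0" "C\<^sup>2 + S\<^sup>2 = 1" and "a * C \<le> 1" "b * S \<le> 1" "a * S + b * C \<le> 1"
  shows "a + b \<le> 2" and "C * S \<noteq> 0 \<Longrightarrow> a + b < 2"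
proof -
  \<comment> \<open>The problem is invariant under exchanging \<open>a\<close> with \<open>b\<close> and \<open>C\<close> with \<open>S\<close>.\<close>
  have main: "a + b \<le> 2 \<and> (C * S \<noteq> 0 \<longrightarrow> a + b < 2)"
    if CS: "C \<ge> 0" "S \<ge> 0" "C\<^sup>2 + S\<^sup>2 = 1" and "S \<le> C" and 1: "a * C \<le> 1" and 2: "a * S + b * C \<le> 1"
    for a b C S :: real
  proof -
    have C0: "C > 0" using CS \<open>S \<le> C\<close> by (cases "C = 0") auto
    have "(a * C) * (C - S) \<le> 1 * (C - S)" by (rule mult_right_mono) (use 1 that in auto)
    moreover have "(a * S + b * C) * C \<le> 1 * C" by (rule mult_right_mono) (use 2 C0 in auto)
    ultimately have A: "(a + b) * C\<^sup>2 \<le> 2 * C - S"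
      by (simp add: power2_eq_square algebra_simps)
    have "0 < 1 + C - 2 * C * S" using CS C0 sum_squares_bound[of C S] by simp
    then have "0 \<le> S * (1 + C - 2 * C * S)" and "S > 0 \<Longrightarrow> 0 < S * (1 + C - 2 * C * S)"
      using CS by simp_all
    moreover have "S * (1 + C - 2 * C * S) = (1 + C) * S - 2 * C * (S * S)"
      by (simp add: algebra_simps)
    moreover have "(1 + C) * (2 * C\<^sup>2 - (2 * C - S)) = (1 + C) * S - 2 * C * (1 - C\<^sup>2)"
      by (simp add: power2_eq_square algebra_simps)
    moreover have "1 - C\<^sup>2 = S * S" using CS by (simp add: power2_eq_square)
    ultimately have B: "0 \<le> (1 + C) * (2 * C\<^sup>2 - (2 * C - S))"
      "S > 0 \<Longrightarrow> 0 < (1 + C) * (2 * C\<^sup>2 - (2 * C - S))" by simp_all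
    have "2 * C - S \<le> 2 * C\<^sup>2" "S > 0 \<Longrightarrow> 2 * C - S < 2 * C\<^sup>2"
      using B C0 by (simp_all add: zero_le_mult_iff zero_less_mult_iff)
    then have "(a + b) * C\<^sup>2 \<le> 2 * C\<^sup>2" "S > 0 \<Longrightarrow> (a + b) * C\<^sup>2 < 2 * C\<^sup>2"
      using A by linarith+
    then show ?thesis using C0 CS by (auto simp: less_le)
  qed
  show "a + b \<le> 2" "C * S \<noteq> 0 \<Longrightarrow> a + b < 2"
    using main[of C S a b] main[of S C b a] assms by (cases "S \<le> C"; force simp: ac_simps)+
qed

text \<open>The extremal problem behind \<open>trapezoid_le_2\<close>. If the tilt is small, the first two
  constraints suffice: their sum \<open>(h1 + h2) C \<le> 2 - m S\<close> gives the bound as soon as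
  \<open>2 (1 - C) \<le> m S\<close>, that is, as soon as \<open>2 tan (t/2) \<le> m\<close> for the tilt \<open>t\<close>. By symmetry the other two
  constraints suffice for tilts near a right angle. In the middle range both chords are shorter
  than 1. The ranges overlap if \<open>m > (sqrt 17 - 3) / 2\<close>, about \<open>0.562\<close>, while the application needs
  \<open>sqrt 2 < 2 - m\<close>, that is, \<open>m\<close> below about \<open>0.586\<close>; this is where \<open>m = 0.58\<close> comes from.\<close>
lemma trapezoid_le_2_nonneg:
  fixes h1 h2 C S m :: real
  assumes CS: "C \<ge> 0" "S \<ge> 0" "C\<^sup>2 + S\<^sup>2 = 1" and m: "m = 58/100"
    and a: "h2 * C + m * S \<le> 1" and b: "h1 * C \<le> 1" and c: "h1 * S + m * C \<le> 1" and d: "h2 * S \<le> 1"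
  shows "h1 + h2 \<le> 2" and "C * S \<noteq> 0 \<Longrightarrow> h1 + h2 < 2"
proof -
  have id: "(1 - C) * (1 + C) = S * S" "(1 - S) * (1 + S) = C * C"
    using CS by (simp_all add: power2_eq_square algebra_simps)
  \<comment> \<open>The range of tilts near 0, and after exchanging \<open>C\<close> and \<open>S\<close> the one near a right angle.\<close>
  have near_axis: "k + l \<le> 2 \<and> (S \<noteq> 0 \<longrightarrow> k + l < 2)"
    if "C \<ge> 0" "S \<ge> 0" "(1 - C) * (1 + C) = S * S" and 1: "l * C + m * S \<le> 1" "k * C \<le> 1"
      and 2: "2 * S < m * (1 + C)" for k l C S :: real
  proof -
    have "C > 0"
    proof (rule ccontr)
      assume "\<not> C > 0"
      then have "C = 0" using that by simp
      then have "S * S = 1" using that by simp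
      moreover have "S * S < 1 * 1" by (rule mult_strict_mono) (use 2 \<open>C = 0\<close> m that in auto)
      ultimately show False by simp
    qed
    have "2 * (1 - C) * (1 + C) = 2 * S * S" using that(3) by (simp only: mult.assoc)
    also have "\<dots> \<le> (m * S) * (1 + C)"
      using mult_right_mono[OF less_imp_le[OF 2], of S] that by (simp add: algebra_simps)
    finally have w: "2 * (1 - C) \<le> m * S" using \<open>C > 0\<close> by simp
    have st: "2 * (1 - C) < m * S" if "S > 0"
    proof -
      have "2 * (1 - C) * (1 + C) = 2 * S * S"
        using \<open>(1 - C) * (1 + C) = S * S\<close> by (simp only: mult.assoc)
      also have "\<dots> < (m * S) * (1 + C)"
        using mult_strict_right_mono[OF 2 that] by (simp add: algebra_simps)
      finally show ?thesis using \<open>C > 0\<close> by simp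
    qed
    have "(k + l) * C \<le> 2 * C" "S > 0 \<Longrightarrow> (k + l) * C < 2 * C"
      using 1 w st by (simp_all add: algebra_simps)
    then show ?thesis using \<open>C > 0\<close> \<open>S \<ge> 0\<close> by (auto simp: less_le)
  qed
  \<comment> \<open>Failing the bound for tilts near an axis implies the bound used in the middle range.\<close>
  have overlap: "C < m * (1 + S)" if "C \<ge> 0" "S \<ge> 0" "(1 - S) * (1 + S) = C * C" "2 * S \<ge> m * (1 + C)"
    for C S :: real
  proof (rule ccontr)
    assume "\<not> ?thesis"
    then have n: "58/100 * (1 + S) \<le> C" by (simp add: m)
    have "(58/100 * (1 + S)) * (58/100 * (1 + S)) \<le> C * C"
      by (rule mult_mono[OF n n]) (use that in simp_all)
    then have "(58/100 * (58/100) * (1 + S)) * (1 + S) \<le> (1 - S) * (1 + S)"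
      unfolding that(3) by (simp only: mult_ac)
    then have "58/100 * (58/100) * (1 + S) \<le> 1 - S"
      by (rule mult_right_le_imp_le) (use that in simp)
    then show False using n that(4) unfolding m by argo
  qed
  \<comment> \<open>In the middle range, \<open>k S + m C \<le> 1\<close> forces \<open>k < 1\<close> because then \<open>S + m C > 1\<close>.\<close>
  have short: "k < 1" if "C < m * (1 + S)" "C > 0" "S > 0" "(1 - S) * (1 + S) = C * C" "k * S + m * C \<le> 1"
    for C S k :: real
  proof -
    have "(1 - S) * (1 + S) < (m * C) * (1 + S)"
      using mult_strict_left_mono[OF that(1,2)] that(4) by (simp add: algebra_simps)
    then have "1 - S < m * C" by (rule mult_right_less_imp_less) (use that in simp)
    then have "k * S < 1 * S" using that(5) by linarith
    then show ?thesis by (rule mult_right_less_imp_less) (use that in simp)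
  qed
  consider "2 * S < m * (1 + C)" | "2 * C < m * (1 + S)"
    | "2 * S \<ge> m * (1 + C)" "2 * C \<ge> m * (1 + S)" by linarith
  then have "h1 + h2 \<le> 2 \<and> (C * S \<noteq> 0 \<longrightarrow> h1 + h2 < 2)"
  proof cases
    case 1
    then show ?thesis using near_axis[of C S h2 h1] CS id a b by auto
  next
    case 2
    then show ?thesis using near_axis[of S C h1 h2] CS id c d by auto
  next
    case 3
    then have "C > 0" "S > 0" using m CS by auto
    moreover have "C < m * (1 + S)" using overlap[of C S] 3 CS id by blast
    moreover have "S < m * (1 + C)" using overlap[of S C] 3 CS id by blast
    ultimately have "h1 < 1" "h2 < 1" using short[of C S h1] short[of S C h2] id a c by auto
    then show ?thesis by simp
  qed
  then show "h1 + h2 \<le> 2" "C * S \<noteq> 0 \<Longrightarrow> h1 + h2 < 2" by auto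
qed

text \<open>The hypotenuse of the right triangle has the projections \<open>c a - s b\<close> and \<open>s a + c b\<close> (up to
  sign) on the sides of the unit square. Depending on the quadrant of the tilt, one of them is a sum of two
  terms of the same sign, which is the constraint that couples the two legs.\<close>
lemma legs_le_2:
  assumes K: "fits c s K" and 0: "(x0, y0) \<in> K" and 1: "(x1, y0) \<in> K" and 2: "(x0, y1) \<in> K"
  shows "\<bar>x1 - x0\<bar> + \<bar>y1 - y0\<bar> \<le> 2" and "c * s \<noteq> 0 \<Longrightarrow> \<bar>x1 - x0\<bar> + \<bar>y1 - y0\<bar> < 2"
proof -
  define a b where "a = x1 - x0" and "b = y1 - y0"
  have axis: "\<bar>a\<bar> * \<bar>c\<bar> \<le> 1" "\<bar>a\<bar> * \<bar>s\<bar> \<le> 1" "\<bar>b\<bar> * \<bar>c\<bar> \<le> 1" "\<bar>b\<bar> * \<bar>s\<bar> \<le> 1"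
    using fitsD[OF K 1 0] fitsD[OF K 2 0]
    by (simp_all add: a_def b_def abs_mult mult.commute)
  have hyp: "\<bar>c * a + (- s * b)\<bar> \<le> 1" "\<bar>s * a + c * b\<bar> \<le> 1"
    using fitsD[OF K 1 2] by (simp_all add: a_def b_def algebra_simps abs_if split: if_splits)
  have unit: "\<bar>c\<bar>\<^sup>2 + \<bar>s\<bar>\<^sup>2 = 1" "\<bar>s\<bar>\<^sup>2 + \<bar>c\<bar>\<^sup>2 = 1"
    using fits_unit[OF K] by simp_all
  have "(s * a) * (c * b) \<ge> 0 \<or> (c * a) * (- s * b) \<ge> 0"
    by (cases "s * a * (c * b) \<ge> 0") (auto simp: algebra_simps)
  then consider "\<bar>a\<bar> * \<bar>s\<bar> + \<bar>b\<bar> * \<bar>c\<bar> \<le> 1" | "\<bar>a\<bar> * \<bar>c\<bar> + \<bar>b\<bar> * \<bar>s\<bar> \<le> 1"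
    using hyp abs_add_same_sign[of "s * a" "c * b"] abs_add_same_sign[of "c * a" "- s * b"]
    by (auto simp: abs_mult mult.commute)
  then have "\<bar>a\<bar> + \<bar>b\<bar> \<le> 2 \<and> (c * s \<noteq> 0 \<longrightarrow> \<bar>a\<bar> + \<bar>b\<bar> < 2)"
  proof cases
    case 1
    then show ?thesis
      using legs_le_2_nonneg[OF abs_ge_zero abs_ge_zero unit(1) axis(1,4)] by simp
  next
    case 2
    then show ?thesis
      using legs_le_2_nonneg[OF abs_ge_zero abs_ge_zero unit(2) axis(2,3)] by simp
  qed
  then show "\<bar>x1 - x0\<bar> + \<bar>y1 - y0\<bar> \<le> 2" "c * s \<noteq> 0 \<Longrightarrow> \<bar>x1 - x0\<bar> + \<bar>y1 - y0\<bar> < 2"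
    by (auto simp: a_def b_def)
qed

text \<open>For each of the two directions of the unit square, the signs decide which diagonal of the
  trapezoid projects to a sum of two terms of the same sign. As both horizontal sides extend to the same
  side of the vertical one, the two directions single out different diagonals, so that each horizontal side
  obtains a constraint.\<close>
lemma trapezoid_le_2:
  assumes K: "fits c s K" and pts: "(x0, y0) \<in> K" "(x0, y1) \<in> K" "(x1, y1) \<in> K" "(x2, y0) \<in> K"
    and same: "(x1 - x0) * (x2 - x0) \<ge> 0" and m: "\<bar>y1 - y0\<bar> = 58/100"
  shows "\<bar>x1 - x0\<bar> + \<bar>x2 - x0\<bar> \<le> 2" and "c * s \<noteq> 0 \<Longrightarrow> \<bar>x1 - x0\<bar> + \<bar>x2 - x0\<bar> < 2"
proof -
  define h k t where "h = x1 - x0" and "k = x2 - x0" and "t = y1 - y0"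
  have m: "\<bar>t\<bar> = 58/100" and same: "h * k \<ge> 0" using m same by (simp_all add: h_def k_def t_def)
  have axis: "\<bar>h\<bar> * \<bar>c\<bar> \<le> 1" "\<bar>h\<bar> * \<bar>s\<bar> \<le> 1" "\<bar>k\<bar> * \<bar>c\<bar> \<le> 1" "\<bar>k\<bar> * \<bar>s\<bar> \<le> 1"
    using fitsD[OF K pts(3,2)] fitsD[OF K pts(4,1)]
    by (simp_all add: h_def k_def abs_mult mult.commute)
  have diag: "\<bar>c * h + s * t\<bar> \<le> 1" "\<bar>c * t + (- s * h)\<bar> \<le> 1"
    "\<bar>c * k + (- s * t)\<bar> \<le> 1" "\<bar>c * t + s * k\<bar> \<le> 1"
    using fitsD[OF K pts(3,1)] fitsD[OF K pts(4,2)]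
    by (simp_all add: h_def k_def t_def algebra_simps abs_if split: if_splits)
  have unit: "\<bar>c\<bar>\<^sup>2 + \<bar>s\<bar>\<^sup>2 = 1" "\<bar>s\<bar>\<^sup>2 + \<bar>c\<bar>\<^sup>2 = 1"
    using fits_unit[OF K] by simp_all
  have tri: "\<bar>h\<bar> * \<bar>c\<bar> + \<bar>t\<bar> * \<bar>s\<bar> \<le> 1" if "c * s * t * h \<ge> 0"
    using diag(1) abs_add_same_sign[of "c * h" "s * t"] that by (simp add: abs_mult mult_ac)
  have tri2: "\<bar>k\<bar> * \<bar>s\<bar> + \<bar>t\<bar> * \<bar>c\<bar> \<le> 1" if "c * s * t * k \<ge> 0"
    using diag(4) abs_add_same_sign[of "c * t" "s * k"] that by (simp add: abs_mult mult_ac)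
  have tri3: "\<bar>h\<bar> * \<bar>s\<bar> + \<bar>t\<bar> * \<bar>c\<bar> \<le> 1" if "c * s * t * h \<le> 0"
    using diag(2) abs_add_same_sign[of "c * t" "- s * h"] that by (simp add: abs_mult mult_ac)
  have tri4: "\<bar>k\<bar> * \<bar>c\<bar> + \<bar>t\<bar> * \<bar>s\<bar> \<le> 1" if "c * s * t * k \<le> 0"
    using diag(3) abs_add_same_sign[of "c * k" "- s * t"] that by (simp add: abs_mult mult_ac)
  have "(c * s * t * h \<ge> 0 \<and> c * s * t * k \<ge> 0) \<or> (c * s * t * h \<le> 0 \<and> c * s * t * k \<le> 0)"
  proof -
    have "(h \<ge> 0 \<and> k \<ge> 0) \<or> (h \<le> 0 \<and> k \<le> 0)" using same by (simp add: zero_le_mult_iff)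
    then show ?thesis
      by (cases "c * s * t \<ge> 0")
        (auto intro: mult_nonneg_nonneg mult_nonneg_nonpos mult_nonpos_nonneg mult_nonpos_nonpos
          simp del: mult_eq_0_iff zero_le_mult_iff)
  qed
  then have "\<bar>h\<bar> + \<bar>k\<bar> \<le> 2 \<and> (c * s \<noteq> 0 \<longrightarrow> \<bar>h\<bar> + \<bar>k\<bar> < 2)"
  proof
    assume "c * s * t * h \<ge> 0 \<and> c * s * t * k \<ge> 0"
    then show ?thesis
      using trapezoid_le_2_nonneg[OF abs_ge_zero abs_ge_zero unit(2) m tri2 axis(2) tri axis(3)]
      by simp
  next
    assume "c * s * t * h \<le> 0 \<and> c * s * t * k \<le> 0"
    then show ?thesis
      using trapezoid_le_2_nonneg[OF abs_ge_zero abs_ge_zero unit(1) m tri4 axis(1) tri3 axis(4)]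
      by simp
  qed
  then show "\<bar>x1 - x0\<bar> + \<bar>x2 - x0\<bar> \<le> 2" "c * s \<noteq> 0 \<Longrightarrow> \<bar>x1 - x0\<bar> + \<bar>x2 - x0\<bar> < 2"
    by (auto simp: h_def k_def)
qed

section \<open>Five unit squares in coordinates\<close>

lemma closed_cover_of_path_meets:
  fixes C D :: "'a::topological_space set"
  assumes g: "continuous_on {0..l} g" and l: "0 \<le> l" and CD: "closed C" "closed D" "g 0 \<in> C" "g l \<in> D"
    and cov: "\<And>t. 0 \<le> t \<Longrightarrow> t \<le> l \<Longrightarrow> g t \<in> C \<union> D"
  obtains t :: real where "0 \<le> t" "t \<le> l" "g t \<in> C" "g t \<in> D"
proof -
  have "closed ({0..l} \<inter> g -` C)" "closed ({0..l} \<inter> g -` D)"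
    using g CD by (auto intro: continuous_closed_preimage)
  moreover have "{0..l} \<subseteq> ({0..l} \<inter> g -` C) \<union> ({0..l} \<inter> g -` D)" by (auto dest: cov)
  moreover have "0 \<in> {0..l} \<inter> g -` C" "l \<in> {0..l} \<inter> g -` D" using l CD by auto
  moreover have "connected {0..l}" by simp
  ultimately have "({0..l} \<inter> g -` C) \<inter> ({0..l} \<inter> g -` D) \<inter> {0..l} \<noteq> {}"
    using connected_closedD[of "{0..l}" "{0..l} \<inter> g -` C" "{0..l} \<inter> g -` D"] by blast
  then show ?thesis using that by auto
qed

lemma meet_on_horizontal:
  fixes C D :: "(real \<times> real) set"
  assumes "closed C" "closed D" "0 \<le> l" "(0, y) \<in> C" "(l, y) \<in> D"
    and "\<And>x. 0 \<le> x \<Longrightarrow> x \<le> l \<Longrightarrow> (x, y) \<in> C \<union> D"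
  obtains x where "0 \<le> x" "x \<le> l" "(x, y) \<in> C" "(x, y) \<in> D"
proof -
  have g: "continuous_on {0..l} (\<lambda>x. (x, y))" by (intro continuous_intros)
  show ?thesis
    by (rule closed_cover_of_path_meets[OF g assms(3,1,2,4,5)]) (rule assms(6) that; assumption)+
qed

lemma meet_on_vertical:
  fixes C D :: "(real \<times> real) set"
  assumes "closed C" "closed D" "0 \<le> l" "(x, 0) \<in> C" "(x, l) \<in> D"
    and "\<And>y. 0 \<le> y \<Longrightarrow> y \<le> l \<Longrightarrow> (x, y) \<in> C \<union> D"
  obtains y where "0 \<le> y" "y \<le> l" "(x, y) \<in> C" "(x, y) \<in> D"
proof -
  have g: "continuous_on {0..l} (\<lambda>y. (x, y))" by (intro continuous_intros)
  show ?thesis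
    by (rule closed_cover_of_path_meets[OF g assms(3,1,2,4,5)]) (rule assms(6) that; assumption)+
qed

text \<open>The squares meet on each of the two chords, and the meeting points cut the chords, of total length
  \<open>2 l \<ge> 4\<close>, into the horizontal sides of two trapezoids, one in \<open>C\<close> and one in \<open>D\<close>. A strict bound for
  one of the trapezoids already contradicts \<open>2 l \<ge> 4\<close>.\<close>
lemma two_squares_miss_a_parallel:
  assumes C: "fits c s C" and D: "fits c' s' D" and l: "l \<ge> 2" and y: "\<bar>y1 - y0\<bar> = 58/100"
    and strict: "l > 2 \<or> c * s \<noteq> 0"
    and c1: "(0, y1) \<in> C" and d1: "(l, y1) \<in> D"
    and cov: "\<And>x y. 0 \<le> x \<Longrightarrow> x \<le> l \<Longrightarrow> y = y0 \<or> y = y1 \<Longrightarrow> (x, y) \<in> C \<union> D"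
  shows False
proof -
  have "(0, y0) \<notin> D" by (rule fits_apart[OF D d1]) (use l in auto)
  then have c0: "(0, y0) \<in> C" using cov[of 0 y0] l by auto
  have "(l, y0) \<notin> C" by (rule fits_apart[OF C c1]) (use l in auto)
  then have d0: "(l, y0) \<in> D" using cov[of l y0] l by auto
  have cl: "closed C" "closed D" using C D by (auto simp: fits_def)
  have l0: "0 \<le> l" using l by simp
  obtain q1 where q1: "0 \<le> q1" "q1 \<le> l" "(q1, y1) \<in> C" "(q1, y1) \<in> D"
    using meet_on_horizontal[OF cl l0 c1 d1] cov by blast
  obtain q0 where q0: "0 \<le> q0" "q0 \<le> l" "(q0, y0) \<in> C" "(q0, y0) \<in> D"
    using meet_on_horizontal[OF cl l0 c0 d0] cov by blast
  have "q1 + q0 \<le> 2" "c * s \<noteq> 0 \<Longrightarrow> q1 + q0 < 2"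
    using trapezoid_le_2[OF C c0 c1 q1(3) q0(3)] q0 q1 y by auto
  moreover have "(l - q1) + (l - q0) \<le> 2"
    using trapezoid_le_2(1)[OF D d0 d1 q1(4) q0(4)] q0 q1 y
      mult_nonpos_nonpos[of "q1 - l" "q0 - l"] by auto
  ultimately show False using l strict by auto
qed

text \<open>The two cases described at the start: the fifth square meets a side of the covered square, which
  is excluded for each side by \<open>two_squares_miss_a_parallel\<close>, or it misses the boundary, which is
  excluded by adding up the legs of the four corner squares.\<close>
lemma five_squares_coords:
  assumes l: "l \<ge> 2"
    and K: "\<And>i. i < 5 \<Longrightarrow> fits (c i) (s i) (K i)"
    and cov: "{0..l} \<times> {0..l} \<subseteq> (\<Union>i<(5::nat). K i)"
    and strict: "l > 2 \<or> (\<forall>i<5. c i * s i \<noteq> 0)"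
  shows False
proof -
  have ex: "\<exists>i<5. (x, y) \<in> K i" if "0 \<le> x" "x \<le> l" "0 \<le> y" "y \<le> l" for x y
  proof -
    have "(x, y) \<in> (\<Union>i<5. K i)" by (rule subsetD[OF cov]) (use that in simp)
    then show ?thesis by blast
  qed
  obtain i1 where i1: "i1 < 5" "(0, 0) \<in> K i1" using ex[of 0 0] l by auto
  obtain i2 where i2: "i2 < 5" "(l, 0) \<in> K i2" using ex[of l 0] l by auto
  obtain i3 where i3: "i3 < 5" "(0, l) \<in> K i3" using ex[of 0 l] l by auto
  obtain i4 where i4: "i4 < 5" "(l, l) \<in> K i4" using ex[of l l] l by auto
  note f = K[OF i1(1)] K[OF i2(1)] K[OF i3(1)] K[OF i4(1)]
  have ne: "i1 \<noteq> i2" "i1 \<noteq> i3" "i1 \<noteq> i4" "i2 \<noteq> i3" "i2 \<noteq> i4" "i3 \<noteq> i4"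
    using fits_apart[OF f(1) i1(2)] fits_apart[OF f(2) i2(2)] fits_apart[OF f(3) i3(2)]
      i2(2) i3(2) i4(2) l by fastforce+
  have "card ({..<5} - {i1, i2, i3, i4}) = 1"
    using i1 i2 i3 i4 ne by (subst card_Diff_subset) auto
  then obtain i5 where i5: "{..<5} - {i1, i2, i3, i4} = {i5}" by (auto simp: card_1_singleton_iff)
  then have "i5 < 5" by auto
  note g = K[OF this]
  have all: "(x, y) \<in> K i1 \<or> (x, y) \<in> K i2 \<or> (x, y) \<in> K i3 \<or> (x, y) \<in> K i4 \<or> (x, y) \<in> K i5"
    if xy: "0 \<le> x" "x \<le> l" "0 \<le> y" "y \<le> l" for x y
  proof -
    obtain i where "i < 5" "(x, y) \<in> K i" using ex xy by blast
    moreover from \<open>i < 5\<close> have "i \<in> {i1, i2, i3, i4} \<or> i \<in> {..<5} - {i1, i2, i3, i4}" by blast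
    ultimately show ?thesis unfolding i5 by auto
  qed
  have str: "l > 2 \<or> c i * s i \<noteq> 0" if "i < 5" for i using strict that by blast
  have no_bottom: "(x, 0) \<notin> K i5" for x
  proof
    assume x: "(x, 0) \<in> K i5"
    show False
    proof (rule two_squares_miss_a_parallel[OF f(3,4) l, of l "l - 58/100"])
      fix x' y assume *: "0 \<le> x'" "x' \<le> l" "y = l - 58 / 100 \<or> y = l"
      then have "y \<ge> 142/100" "y \<le> l" using l by auto
      then have "(x', y) \<notin> K i1" "(x', y) \<notin> K i2" "(x', y) \<notin> K i5"
        using fits_apart[OF f(1) i1(2), of x' y] fits_apart[OF f(2) i2(2), of x' y]
          fits_apart[OF g x, of x' y] by auto
      then show "(x', y) \<in> K i3 \<union> K i4" using all[of x' y] * \<open>y \<ge> _\<close> \<open>y \<le> l\<close> by auto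
    qed (use i3 i4 str in auto)
  qed
  have no_top: "(x, l) \<notin> K i5" for x
  proof
    assume x: "(x, l) \<in> K i5"
    show False
    proof (rule two_squares_miss_a_parallel[OF f(1,2) l, of 0 "58/100"])
      fix x' y assume *: "0 \<le> x'" "x' \<le> l" "y = (58 / 100 :: real) \<or> y = 0"
      then have "l - y \<ge> 142/100" "0 \<le> y" using l by auto
      then have "(x', y) \<notin> K i3" "(x', y) \<notin> K i4" "(x', y) \<notin> K i5"
        using fits_apart[OF f(3) i3(2), of x' y] fits_apart[OF f(4) i4(2), of x' y]
          fits_apart[OF g x, of x' y] by auto
      then show "(x', y) \<in> K i1 \<union> K i2" using all[of x' y] * \<open>l - y \<ge> _\<close> \<open>0 \<le> y\<close> by auto
    qed (use i1 i2 str in auto)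
  qed
  have no_left: "(0, y) \<notin> K i5" for y
  proof
    assume y: "(0, y) \<in> K i5"
    show False
    proof (rule two_squares_miss_a_parallel[OF f(2,4)[THEN fits_swap] l, of l "l - 58/100"])
      fix y' x assume *: "0 \<le> y'" "y' \<le> l" "x = l - 58 / 100 \<or> x = l"
      then have "x \<ge> 142/100" "x \<le> l" using l by auto
      then have "(x, y') \<notin> K i1" "(x, y') \<notin> K i3" "(x, y') \<notin> K i5"
        using fits_apart[OF f(1) i1(2), of x y'] fits_apart[OF f(3) i3(2), of x y']
          fits_apart[OF g y, of x y'] by auto
      then show "(y', x) \<in> {(x, y). (y, x) \<in> K i2} \<union> {(x, y). (y, x) \<in> K i4}"
        using all[of x y'] * \<open>x \<ge> _\<close> \<open>x \<le> l\<close> by auto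
    qed (use i2 i4 str in \<open>auto simp: mult.commute\<close>)
  qed
  have no_right: "(l, y) \<notin> K i5" for y
  proof
    assume y: "(l, y) \<in> K i5"
    show False
    proof (rule two_squares_miss_a_parallel[OF f(1,3)[THEN fits_swap] l, of 0 "58/100"])
      fix y' x assume *: "0 \<le> y'" "y' \<le> l" "x = (58 / 100 :: real) \<or> x = 0"
      then have "l - x \<ge> 142/100" "0 \<le> x" using l by auto
      then have "(x, y') \<notin> K i2" "(x, y') \<notin> K i4" "(x, y') \<notin> K i5"
        using fits_apart[OF f(2) i2(2), of x y'] fits_apart[OF f(4) i4(2), of x y']
          fits_apart[OF g y, of x y'] by auto
      then show "(y', x) \<in> {(x, y). (y, x) \<in> K i1} \<union> {(x, y). (y, x) \<in> K i3}"
        using all[of x y'] * \<open>l - x \<ge> _\<close> \<open>0 \<le> x\<close> by auto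
    qed (use i1 i3 str in \<open>auto simp: mult.commute\<close>)
  qed
  have cl: "closed (K i)" if "i < 5" for i using K[OF that] by (simp add: fits_def)
  note cl = cl[OF i1(1)] cl[OF i2(1)] cl[OF i3(1)] cl[OF i4(1)]
  have l0: "0 \<le> l" using l by simp
  have bottom: "(x, 0) \<in> K i1 \<union> K i2" if "0 \<le> x" "x \<le> l" for x
    using all[of x 0] that l no_bottom[of x]
      fits_apart[OF f(3) i3(2), of x 0] fits_apart[OF f(4) i4(2), of x 0] by auto
  have top: "(x, l) \<in> K i3 \<union> K i4" if "0 \<le> x" "x \<le> l" for x
    using all[of x l] that l no_top[of x]
      fits_apart[OF f(1) i1(2), of x l] fits_apart[OF f(2) i2(2), of x l] by auto
  have left: "(0, y) \<in> K i1 \<union> K i3" if "0 \<le> y" "y \<le> l" for y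
    using all[of 0 y] that l no_left[of y]
      fits_apart[OF f(2) i2(2), of 0 y] fits_apart[OF f(4) i4(2), of 0 y] by auto
  have right: "(l, y) \<in> K i2 \<union> K i4" if "0 \<le> y" "y \<le> l" for y
    using all[of l y] that l no_right[of y]
      fits_apart[OF f(1) i1(2), of l y] fits_apart[OF f(3) i3(2), of l y] by auto
  obtain b where b: "0 \<le> b" "b \<le> l" "(b, 0) \<in> K i1" "(b, 0) \<in> K i2"
    using meet_on_horizontal[OF cl(1,2) l0 i1(2) i2(2) bottom] by blast
  obtain t where t: "0 \<le> t" "t \<le> l" "(t, l) \<in> K i3" "(t, l) \<in> K i4"
    using meet_on_horizontal[OF cl(3,4) l0 i3(2) i4(2) top] by blast
  obtain p where p: "0 \<le> p" "p \<le> l" "(0, p) \<in> K i1" "(0, p) \<in> K i3"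
    using meet_on_vertical[OF cl(1,3) l0 i1(2) i3(2) left] by blast
  obtain r where r: "0 \<le> r" "r \<le> l" "(l, r) \<in> K i2" "(l, r) \<in> K i4"
    using meet_on_vertical[OF cl(2,4) l0 i2(2) i4(2) right] by blast
  note L1 = legs_le_2[OF f(1) i1(2) b(3) p(3)] and L2 = legs_le_2[OF f(2) i2(2) b(4) r(3)]
    and L3 = legs_le_2[OF f(3) i3(2) t(3) p(4)] and L4 = legs_le_2[OF f(4) i4(2) t(4) r(4)]
  show False using L1 L2(1) L3(1) L4(1) b(1,2) t(1,2) p(1,2) r(1,2) l str[OF i1(1)] by auto
qed

section \<open>Orthonormal frames\<close>

lemma orthonormal_expand:
  fixes u v w :: "real ^ 2"
  assumes "norm u = 1" "norm v = 1" "u \<bullet> v = 0"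
  shows "w = (w \<bullet> u) *\<^sub>R u + (w \<bullet> v) *\<^sub>R v"
proof -
  have ne: "u \<noteq> v" using assms by (auto simp: dot_square_norm)
  have "independent {u, v}"
    using assms by (intro pairwise_orthogonal_independent)
      (auto simp: pairwise_def orthogonal_def inner_commute)
  then have "w \<in> span {u, v}"
    using card_eq_dim[of "{u, v}" UNIV] ne by auto
  then obtain a b where "w = a *\<^sub>R u + b *\<^sub>R v"
    by (auto simp: span_insert span_singleton algebra_simps)
  then show ?thesis
    using assms inner_commute[of v u] by (simp add: inner_add_left dot_square_norm)
qed

lemma orthonormal_pair_coords:
  fixes c s c' s' :: real
  assumes "c\<^sup>2 + s\<^sup>2 = 1" "c'\<^sup>2 + s'\<^sup>2 = 1" "c * c' + s * s' = 0"
  shows "(c' = - s \<and> s' = c) \<or> (c' = s \<and> s' = - c)"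
proof -
  \<comment> \<open>The determinant of the orthogonal matrix with rows \<open>(c, s)\<close> and \<open>(c', s')\<close>.\<close>
  define k where "k = c * s' - s * c'"
  have "k\<^sup>2 = (c\<^sup>2 + s\<^sup>2) * (c'\<^sup>2 + s'\<^sup>2) - (c * c' + s * s')\<^sup>2"
    unfolding k_def by (simp add: power2_eq_square algebra_simps)
  then have "k\<^sup>2 = 1" using assms by simp
  then have k: "k = 1 \<or> k = - 1" by (simp add: power2_eq_1_iff)
  have "c' * (c\<^sup>2 + s\<^sup>2) = (c * c' + s * s') * c - k * s"
    "s' * (c\<^sup>2 + s\<^sup>2) = (c * c' + s * s') * s + k * c"
    unfolding k_def by (simp_all add: power2_eq_square algebra_simps)
  then show ?thesis using assms k by auto
qed

lemma closed_is_square: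
  assumes "is_square r K"
  shows "closed K"
proof -
  obtain p u v where K: "K = {p + a *\<^sub>R u + b *\<^sub>R v | a b. a \<in> {0..r} \<and> b \<in> {0..r}}"
    using assms unfolding is_square_def by blast
  have "K = (\<lambda>(a, b). p + a *\<^sub>R u + b *\<^sub>R v) ` ({0..r} \<times> {0..r})"
    unfolding K by (auto simp: image_iff) blast+
  moreover have "compact \<dots>"
    by (intro compact_continuous_image compact_Times)
      (auto simp: case_prod_unfold intro!: continuous_intros)
  ultimately show ?thesis by (simp add: compact_imp_closed)
qed

lemma square_width:
  fixes p u v x y :: "real ^ 2"
  assumes "norm u = 1" "norm v = 1" "u \<bullet> v = 0"
    and K: "K = {p + a *\<^sub>R u + b *\<^sub>R v | a b. a \<in> {0..r} \<and> b \<in> {0..r}}"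
    and "x \<in> K" "y \<in> K"
  shows "\<bar>(x - y) \<bullet> u\<bar> \<le> r" "\<bar>(x - y) \<bullet> v\<bar> \<le> r"
proof -
  obtain a b a' b' where x: "x = p + a *\<^sub>R u + b *\<^sub>R v" "y = p + a' *\<^sub>R u + b' *\<^sub>R v"
    and ab: "a \<in> {0..r}" "b \<in> {0..r}" "a' \<in> {0..r}" "b' \<in> {0..r}"
    using assms by blast
  have "(x - y) \<bullet> u = a - a'" "(x - y) \<bullet> v = b - b'"
    using assms(1-3) inner_commute[of v u] unfolding x
    by (simp_all add: inner_add_left inner_diff_left dot_square_norm)
  then show "\<bar>(x - y) \<bullet> u\<bar> \<le> r" "\<bar>(x - y) \<bullet> v\<bar> \<le> r" using ab by auto
qed

text \<open>The second side \<open>v'\<close> has the coordinates \<open>(- s, c)\<close> up to sign, so that the two numbers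
  \<open>c\<close>, \<open>s\<close> determine both widths.\<close>
lemma fits_coords:
  fixes p u v p' u' v' :: "real ^ 2"
  assumes f: "norm u = 1" "norm v = 1" "u \<bullet> v = 0" and f': "norm u' = 1" "norm v' = 1" "u' \<bullet> v' = 0"
    and K: "K = {p' + a *\<^sub>R u' + b *\<^sub>R v' | a b. a \<in> {0..1} \<and> b \<in> {0..1}}"
  shows "fits (u' \<bullet> u) (u' \<bullet> v) {(x, y). p + x *\<^sub>R u + y *\<^sub>R v \<in> K}"
proof -
  define c s c' s' where "c = u' \<bullet> u" and "s = u' \<bullet> v" and "c' = v' \<bullet> u" and "s' = v' \<bullet> v"
  have u': "u' = c *\<^sub>R u + s *\<^sub>R v" and v': "v' = c' *\<^sub>R u + s' *\<^sub>R v"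
    unfolding c_def s_def c'_def s'_def by (rule orthonormal_expand[OF f])+
  have uu: "u \<bullet> u = 1" "v \<bullet> v = 1" "u \<bullet> v = 0" "v \<bullet> u = 0"
    using f by (simp_all add: dot_square_norm inner_commute)
  have cs: "c\<^sup>2 + s\<^sup>2 = 1" "c'\<^sup>2 + s'\<^sup>2 = 1" "c * c' + s * s' = 0"
  proof -
    have "u' \<bullet> u' = 1" "v' \<bullet> v' = 1" using f' by (simp_all add: dot_square_norm)
    then show "c\<^sup>2 + s\<^sup>2 = 1" "c'\<^sup>2 + s'\<^sup>2 = 1" "c * c' + s * s' = 0"
      using f'(3) unfolding u' v'
      by (simp_all add: inner_add_left inner_add_right uu power2_eq_square mult.commute)
  qed
  have w: "\<bar>c * (x - x') + s * (y - y')\<bar> \<le> 1" "\<bar>c * (y - y') - s * (x - x')\<bar> \<le> 1"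
    if "p + x *\<^sub>R u + y *\<^sub>R v \<in> K" "p + x' *\<^sub>R u + y' *\<^sub>R v \<in> K" for x y x' y'
  proof -
    note sq = square_width[OF f' K that]
    have d: "p + x *\<^sub>R u + y *\<^sub>R v - (p + x' *\<^sub>R u + y' *\<^sub>R v) = (x - x') *\<^sub>R u + (y - y') *\<^sub>R v"
      by (simp add: algebra_simps)
    have "\<bar>c * (x - x') + s * (y - y')\<bar> \<le> 1" "\<bar>c' * (x - x') + s' * (y - y')\<bar> \<le> 1"
      using sq unfolding d u' v' by (simp_all add: inner_add_left inner_add_right uu mult.commute)
    then show "\<bar>c * (x - x') + s * (y - y')\<bar> \<le> 1" "\<bar>c * (y - y') - s * (x - x')\<bar> \<le> 1"
      using orthonormal_pair_coords[OF cs] by (auto simp: abs_if split: if_splits)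
  qed
  have "is_square 1 K" unfolding is_square_def using f' K by auto
  then have "closed ((\<lambda>z. p + fst z *\<^sub>R u + snd z *\<^sub>R v) -` K)"
    by (intro continuous_closed_vimage closed_is_square) (auto intro!: continuous_intros)
  moreover have "(\<lambda>z. p + fst z *\<^sub>R u + snd z *\<^sub>R v) -` K = {(x, y). p + x *\<^sub>R u + y *\<^sub>R v \<in> K}"
    by auto
  ultimately show ?thesis using w cs(1) unfolding fits_def c_def s_def by auto
qed

section \<open>Parallel sides\<close>

lemma line_scale_direction:
  fixes x w :: "'a::real_vector"
  assumes "k \<noteq> 0"
  shows "range (\<lambda>t. x + t *\<^sub>R (k *\<^sub>R w)) = range (\<lambda>t. x + t *\<^sub>R w)"
proof (intro set_eqI iffI)
  fix z assume "z \<in> range (\<lambda>t. x + t *\<^sub>R w)"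
  then obtain t where "z = x + t *\<^sub>R w" by blast
  then have "z = x + (t / k) *\<^sub>R (k *\<^sub>R w)" using assms by simp
  then show "z \<in> range (\<lambda>t. x + t *\<^sub>R (k *\<^sub>R w))" by blast
qed auto

text \<open>An edge is a face of dimension one, so it spans a line. Take two of its points. If their
  \<open>u\<close>-coordinates agree, the line has direction \<open>v\<close>. Otherwise their midpoint can be moved both ways
  within the square in direction \<open>u\<close>; being a face, the edge contains these
  movements, so the line has direction \<open>u\<close>.\<close>
lemma edge_of_square_direction:
  fixes p u v :: "real ^ 2"
  assumes f: "norm u = 1" "norm v = 1" "u \<bullet> v = 0"
    and K: "K = {p + a *\<^sub>R u + b *\<^sub>R v | a b. a \<in> {0..r} \<and> b \<in> {0..r}}"
    and e: "e edge_of K"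
  obtains x where "affine hull e = range (\<lambda>t. x + t *\<^sub>R u)" | x where "affine hull e = range (\<lambda>t. x + t *\<^sub>R v)"
proof -
  have face: "e face_of K" and dim: "aff_dim e = 1" using e by (auto simp: edge_of_def)
  obtain x y where xy: "x \<in> e" "y \<in> e" "x \<noteq> y"
  proof -
    have "e \<noteq> {}" "e \<noteq> {z}" for z using dim by auto
    then show ?thesis using that by blast
  qed
  have "affine hull {x, y} = affine hull e"
    by (rule affine_dim_equal) (use xy dim in \<open>auto simp: aff_dim_2 hull_mono\<close>)
  then have line: "affine hull e = range (\<lambda>t. x + t *\<^sub>R (y - x))"
    by (auto simp: affine_hull_2_alt)
  have dir: "affine hull e = range (\<lambda>t. x + t *\<^sub>R w)" if "y - x = k *\<^sub>R w" for k w
    unfolding line that using xy that by (intro line_scale_direction) auto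
  have eK: "e \<subseteq> K" using face by (rule face_of_imp_subset)
  obtain a b a' b' where x: "x = p + a *\<^sub>R u + b *\<^sub>R v" and y: "y = p + a' *\<^sub>R u + b' *\<^sub>R v"
    and ab: "a \<in> {0..r}" "b \<in> {0..r}" "a' \<in> {0..r}" "b' \<in> {0..r}"
    using xy eK unfolding K by blast
  show ?thesis
  proof (cases "a = a'")
    case True
    have "y - x = (b' - b) *\<^sub>R v" unfolding x y True by (simp add: algebra_simps)
    then show ?thesis using dir that(2) by blast
  next
    case False
    define m where "m = (a + a') / 2"
    define n where "n = (b + b') / 2"
    have mid: "p + m *\<^sub>R u + n *\<^sub>R v \<in> e"
    proof -
      have "(1/2) *\<^sub>R x + (1/2) *\<^sub>R y \<in> e"
        using face_of_imp_convex[OF face] xy by (simp add: convexD)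
      also have "(1/2) *\<^sub>R x + (1/2) *\<^sub>R y = p + m *\<^sub>R u + n *\<^sub>R v"
        unfolding x y m_def n_def by (simp add: vec_eq_iff field_simps)
      finally show ?thesis .
    qed
    define h where "h = min m (r - m)"
    have "0 < m" "m < r" using False ab by (auto simp: m_def)
    then have h: "h > 0" "m + h \<le> r" "m - h \<ge> 0" by (auto simp: h_def min_def)
    have n: "n \<in> {0..r}" using ab by (auto simp: n_def)
    define P where "P k = p + k *\<^sub>R u + n *\<^sub>R v" for k
    have PK: "P (m + h) \<in> K" "P (m - h) \<in> K" unfolding P_def K using h n by force+
    have ne: "P (m - h) \<noteq> P (m + h)" using h f(1) by (auto simp: P_def)
    moreover have "P m = (1 - 1/2) *\<^sub>R P (m - h) + (1/2) *\<^sub>R P (m + h)"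
      unfolding P_def by (simp add: vec_eq_iff field_simps)
    ultimately have "P m \<in> open_segment (P (m - h)) (P (m + h))"
      unfolding in_segment by (intro conjI exI[of _ "1/2"]) auto
    then have "P (m - h) \<in> e" "P (m + h) \<in> e"
      using face mid PK unfolding face_of_def P_def by blast+
    then have "P (m - h) \<in> affine hull e" "P (m + h) \<in> affine hull e" by (auto intro: hull_inc)
    then obtain t t' where t: "P (m - h) = x + t *\<^sub>R (y - x)" "P (m + h) = x + t' *\<^sub>R (y - x)"
      unfolding line by blast
    have "(2 * h) *\<^sub>R u = P (m + h) - P (m - h)" unfolding P_def by (simp add: algebra_simps flip: scaleR_add_left)
    also have "\<dots> = (t' - t) *\<^sub>R (y - x)" unfolding t by (simp add: algebra_simps)
    finally have eq: "(2 * h) *\<^sub>R u = (t' - t) *\<^sub>R (y - x)" .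
    then have "t' - t \<noteq> 0" using h f(1) by auto
    then have "y - x = (2 * h / (t' - t)) *\<^sub>R u"
      by (simp add: divide_inverse_commute flip: scaleR_scaleR) (simp add: eq)
    then show ?thesis using dir that(1) by blast
  qed
qed

lemma square_side_edge:
  fixes p u v :: "real ^ 2"
  assumes f: "norm u = 1" "norm v = 1" "u \<bullet> v = 0" and r: "r > 0"
    and K: "K = {p + a *\<^sub>R u + b *\<^sub>R v | a b. a \<in> {0..r} \<and> b \<in> {0..r}}"
  obtains e where "e edge_of K" "affine hull e = range (\<lambda>t. p + t *\<^sub>R u)"
proof -
  have uu: "u \<bullet> u = 1" "v \<bullet> v = 1" "u \<bullet> v = 0" "v \<bullet> u = 0"
    using f by (simp_all add: dot_square_norm inner_commute)
  define e where "e = K \<inter> {z. v \<bullet> z = v \<bullet> p}"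
  have "convex K"
  proof -
    have "K = (\<lambda>z. p + z) ` (\<lambda>(a, b). a *\<^sub>R u + b *\<^sub>R v) ` ({0..r} \<times> {0..r})"
      unfolding K by (force simp: image_iff add.assoc)
    moreover have "linear (\<lambda>(a, b). a *\<^sub>R u + b *\<^sub>R v)"
      by (rule linearI) (auto simp: algebra_simps)
    ultimately show ?thesis
      by (metis convex_Times convex_linear_image convex_real_interval(5) convex_translation)
  qed
  moreover have "v \<bullet> z \<ge> v \<bullet> p" if "z \<in> K" for z
    using that unfolding K by (auto simp: inner_add_right uu)
  ultimately have "e face_of K" unfolding e_def by (rule face_of_Int_supporting_hyperplane_ge)
  have e: "e = closed_segment p (p + r *\<^sub>R u)"
  proof -
    have "e = {p + a *\<^sub>R u | a. a \<in> {0..r}}"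
      unfolding e_def K using r by (auto simp: inner_add_right uu) force
    also have "\<dots> = closed_segment p (p + r *\<^sub>R u)"
    proof (intro set_eqI iffI)
      fix z assume "z \<in> {p + a *\<^sub>R u | a. a \<in> {0..r}}"
      then obtain a where "z = p + a *\<^sub>R u" "a \<in> {0..r}" by blast
      then show "z \<in> closed_segment p (p + r *\<^sub>R u)"
        unfolding in_segment using r by (intro exI[of _ "a / r"]) (auto simp: algebra_simps)
    next
      fix z assume "z \<in> closed_segment p (p + r *\<^sub>R u)"
      then obtain t where "0 \<le> t" "t \<le> 1" "z = p + (t * r) *\<^sub>R u"
        unfolding in_segment by (auto simp: algebra_simps)
      then show "z \<in> {p + a *\<^sub>R u | a. a \<in> {0..r}}"
        using r by (intro CollectI exI[of _ "t * r"]) (auto simp: mult_left_le_one_le)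
    qed
    finally show ?thesis .
  qed
  have "u \<noteq> 0" using f by auto
  then have "aff_dim e = 1" unfolding e segment_convex_hull aff_dim_convex_hull using r by (simp add: aff_dim_2)
  moreover have "affine hull e = range (\<lambda>t. p + t *\<^sub>R u)"
  proof -
    have "affine hull e = range (\<lambda>t. p + t *\<^sub>R (r *\<^sub>R u))"
      unfolding e segment_convex_hull by (simp add: affine_hull_2_alt)
    then show ?thesis using line_scale_direction[of r p u] r by simp
  qed
  ultimately show ?thesis using that \<open>e face_of K\<close> unfolding edge_of_def by blast
qed

text \<open>If one side of \<open>K\<close> is orthogonal to \<open>u\<close> or to \<open>v\<close>, then each of the directions \<open>u'\<close> and \<open>v'\<close> is a
  multiple of \<open>u\<close> or \<open>v\<close>, and both of these directions occur among the edges of \<open>Q\<close>.\<close>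
lemma sides_parallelI:
  fixes p u v p' u' v' :: "real ^ 2"
  assumes f: "norm u = 1" "norm v = 1" "u \<bullet> v = 0" and r: "r > 0"
    and Q: "Q = {p + a *\<^sub>R u + b *\<^sub>R v | a b. a \<in> {0..r} \<and> b \<in> {0..r}}"
    and f': "norm u' = 1" "norm v' = 1" "u' \<bullet> v' = 0"
    and K: "K = {p' + a *\<^sub>R u' + b *\<^sub>R v' | a b. a \<in> {0..r'} \<and> b \<in> {0..r'}}"
    and par: "(u' \<bullet> u) * (u' \<bullet> v) = 0"
  shows "sides_parallel K Q"
proof -
  define c s c' s' where "c = u' \<bullet> u" and "s = u' \<bullet> v" and "c' = v' \<bullet> u" and "s' = v' \<bullet> v"
  have u': "u' = c *\<^sub>R u + s *\<^sub>R v" and v': "v' = c' *\<^sub>R u + s' *\<^sub>R v"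
    unfolding c_def s_def c'_def s'_def by (rule orthonormal_expand[OF f])+
  have uu: "u \<bullet> u = 1" "v \<bullet> v = 1" "u \<bullet> v = 0" "v \<bullet> u = 0"
    using f by (simp_all add: dot_square_norm inner_commute)
  have "c * c' + s * s' = 0"
    using f'(3) unfolding u' v' by (simp add: inner_add_left inner_add_right uu mult.commute)
  moreover have "c = 0 \<or> s = 0" using par unfolding c_def s_def by simp
  moreover have "c \<noteq> 0 \<or> s \<noteq> 0" using f'(1) u' by auto
  ultimately have "(s = 0 \<and> c' = 0) \<or> (c = 0 \<and> s' = 0)" by auto
  moreover have "u' \<noteq> 0" "v' \<noteq> 0" using f' by auto
  ultimately have dirs: "\<exists>k d. k \<noteq> 0 \<and> w = k *\<^sub>R d \<and> (d = u \<or> d = v)" if "w = u' \<or> w = v'" for w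
    using that u' v' by (auto; metis scaleR_eq_0_iff)
  have Q': "Q = {p + a *\<^sub>R v + b *\<^sub>R u | a b. a \<in> {0..r} \<and> b \<in> {0..r}}"
    unfolding Q by (auto simp: add.assoc) (metis add.commute)+
  have side: "\<exists>e. e edge_of Q \<and> affine hull e = range (\<lambda>t. p + t *\<^sub>R d)" if "d = u \<or> d = v" for d
    using that square_side_edge[OF f r Q] square_side_edge[OF f(2,1) uu(4) r Q'] by metis
  show ?thesis
    unfolding sides_parallel_def
  proof (intro allI impI)
    fix e assume "e edge_of K"
    then obtain x w where w: "w = u' \<or> w = v'" and e: "affine hull e = range (\<lambda>t. x + t *\<^sub>R w)"
      using edge_of_square_direction[OF f' K] by metis
    obtain k d where k: "k \<noteq> 0" "w = k *\<^sub>R d" "d = u \<or> d = v" using dirs[OF w] by blast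
    obtain g where g: "g edge_of Q" "affine hull g = range (\<lambda>t. p + t *\<^sub>R d)"
      using side[OF k(3)] by blast
    have "affine hull e = range (\<lambda>t. x + t *\<^sub>R d)"
      unfolding e k(2) by (rule line_scale_direction[OF k(1)])
    then have "affine hull g = (\<lambda>z. (p - x) + z) ` (affine hull e)"
      unfolding g(2) by (simp add: image_image algebra_simps)
    then have "affine_parallel (affine hull e) (affine hull g)"
      unfolding affine_parallel_def by blast
    then show "\<exists>f. f edge_of Q \<and> affine_parallel (affine hull e) (affine hull f)"
      using g(1) by blast
  qed
qed

section \<open>Covering by five unit squares\<close>

lemma five_squares:
  assumes Q: "is_square l Q" and l: "l \<ge> 2" and F: "unit_squares 5 F" and cov: "Q \<subseteq> (\<Union>i<5. F i)"
  shows "l = 2 \<and> (\<exists>i<5. sides_parallel (F i) Q)"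
proof (rule ccontr)
  assume neg: "\<not> ?thesis"
  obtain p u v where f: "norm u = 1" "norm v = 1" "u \<bullet> v = 0"
    and Qeq: "Q = {p + a *\<^sub>R u + b *\<^sub>R v | a b. a \<in> {0..l} \<and> b \<in> {0..l}}"
    using Q unfolding is_square_def by blast
  define K where "K i = {(x, y). p + x *\<^sub>R u + y *\<^sub>R v \<in> F i}" for i
  have "\<exists>c s. fits c s (K i) \<and> (c * s = 0 \<longrightarrow> sides_parallel (F i) Q)" if i: "i < 5" for i
  proof -
    obtain p' u' v' where f': "norm u' = 1" "norm v' = 1" "u' \<bullet> v' = 0"
      and Fi: "F i = {p' + a *\<^sub>R u' + b *\<^sub>R v' | a b. a \<in> {0..1} \<and> b \<in> {0..1}}"
      using F i unfolding unit_squares_def is_square_def by blast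
    have "fits (u' \<bullet> u) (u' \<bullet> v) (K i)"
      unfolding K_def by (rule fits_coords[OF f f' Fi])
    moreover have "sides_parallel (F i) Q" if "(u' \<bullet> u) * (u' \<bullet> v) = 0"
      by (rule sides_parallelI[OF f _ Qeq f' Fi that]) (use l in simp)
    ultimately show ?thesis by blast
  qed
  then obtain c s where K: "\<And>i. i < 5 \<Longrightarrow> fits (c i) (s i) (K i)"
    and par: "\<And>i. i < 5 \<Longrightarrow> c i * s i = 0 \<Longrightarrow> sides_parallel (F i) Q"
    by metis
  have covK: "{0..l} \<times> {0..l} \<subseteq> (\<Union>i<5. K i)"
  proof
    fix z assume "z \<in> {0..l} \<times> {0..l}"
    then obtain x y where z: "z = (x, y)" "x \<in> {0..l}" "y \<in> {0..l}" by blast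
    then have "p + x *\<^sub>R u + y *\<^sub>R v \<in> Q" unfolding Qeq by blast
    then obtain i where "i < 5" "p + x *\<^sub>R u + y *\<^sub>R v \<in> F i" using cov by blast
    then show "z \<in> (\<Union>i<5. K i)" unfolding K_def z by blast
  qed
  have "l > 2 \<or> (\<forall>i<5. c i * s i \<noteq> 0)"
    using neg l par by (cases "l = 2") auto
  then show False using five_squares_coords[OF l K covK] by blast
qed

lemma coverable_5_2: "coverable 5 2"
proof -
  define e1 e2 :: "real ^ 2" where "e1 = axis 1 1" and "e2 = axis 2 1"
  have e: "norm e1 = 1" "norm e2 = 1" "e1 \<bullet> e2 = 0"
    by (simp_all add: e1_def e2_def inner_axis_axis)
  define sq where "sq r p = {p + a *\<^sub>R e1 + b *\<^sub>R e2 | a b. a \<in> {0..r} \<and> b \<in> {0..r}}"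
    for r :: real and p :: "real ^ 2"
  have is_sq: "is_square r (sq r p)" if "r > 0" for r p
    unfolding is_square_def sq_def using that e by blast
  \<comment> \<open>The indices 0 to 3 run through a 2 by 2 grid; the fifth square lies above it.\<close>
  define F :: "nat \<Rightarrow> (real ^ 2) set"
    where "F i = sq 1 (real (i mod 2) *\<^sub>R e1 + real (i div 2) *\<^sub>R e2)" for i
  have "sq 2 0 \<subseteq> (\<Union>i<5. F i)"
  proof
    fix z assume "z \<in> sq 2 0"
    then obtain a b where z: "z = a *\<^sub>R e1 + b *\<^sub>R e2" and ab: "0 \<le> a" "a \<le> 2" "0 \<le> b" "b \<le> 2"
      unfolding sq_def by auto
    define m n :: nat where "m = (if a \<le> 1 then 0 else 1)" and "n = (if b \<le> 1 then 0 else 1)"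
    define i where "i = m + 2 * n"
    have i: "i < 5" "i mod 2 = m" "i div 2 = n" unfolding i_def m_def n_def by auto
    have "z = (real m *\<^sub>R e1 + real n *\<^sub>R e2) + (a - real m) *\<^sub>R e1 + (b - real n) *\<^sub>R e2"
      unfolding z by (simp add: algebra_simps)
    moreover have "a - real m \<in> {0..1}" "b - real n \<in> {0..1}" using ab by (auto simp: m_def n_def)
    ultimately have "z \<in> F i" unfolding F_def sq_def i by blast
    then show "z \<in> (\<Union>i<5. F i)" using i(1) by blast
  qed
  moreover have "unit_squares 5 F" unfolding unit_squares_def F_def using is_sq by simp
  ultimately show ?thesis unfolding coverable_def using is_sq[of 2 0] by auto
qed

theorem theorem1p3:
  "S 5 = 2 \<and>
   (\<forall>F Q. unit_squares 5 F \<and> is_square 2 Q \<and> Q \<subseteq> (\<Union>i<5. F i) \<longrightarrow>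
      (\<exists>i<5. sides_parallel (F i) Q))"
proof
  have "s \<le> 2" if "coverable 5 s" for s
    using that five_squares unfolding coverable_def by (metis linorder_le_cases order_refl)
  then show "S 5 = 2" unfolding S_def by (intro Greatest_equality coverable_5_2)
  show "\<forall>F Q. unit_squares 5 F \<and> is_square 2 Q \<and> Q \<subseteq> (\<Union>i<5. F i) \<longrightarrow>
      (\<exists>i<5. sides_parallel (F i) Q)"
    using five_squares[of 2] by blast
qed

end
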